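(* Let $\varepsilon\in\{1,-1\}$ and let $A\in\mathbb{R}^{(n+1)\times(n+1)}$ be a semisimple invertible matrix which is similar to $\varepsilon A^{-1}$. Then: (1) There exists a symmetric invertible matrix $M\in\mathbb{R}^{(n+1)\times(n+1)}$ such that $A^TMA=\varepsilon M$. (2) Let $\sigma_\varepsilon(A)$ be the set of all distinct (complex) eigenvalues $\lambda$ of $A$ verifying either $|\lambda|<1$, or $|\lambda|=1$ together with $\mathrm{Im}(\lambda)>0$ if $\varepsilon=1$, respectively $\mathrm{Re}(\lambda)>0$ if $\varepsilon=-1$. Then $$\dim \mathcal{C}_\varepsilon(A)=\frac{m(\sqrt{\varepsilon})^2+m(\sqrt{\varepsilon})+m(-\sqrt{\varepsilon})^2+m(-\sqrt{\varepsilon})}{2}+\sum_{\lambda\in\sigma_\varepsilon(A)}m(\lambda)^2 .$$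
   Context: Here $n\ge 2$ is an integer. A real matrix is semisimple if it is diagonalizable as a complex matrix. For $\lambda\in\mathbb{C}$, $m(\lambda)$ denotes the algebraic multiplicity of $\lambda$ as an eigenvalue of $A$, with $m(\lambda)=0$ if $\lambda$ is not an eigenvalue. $\sqrt{\varepsilon}$ denotes $1$ if $\varepsilon=1$ and the imaginary unit $i$ if $\varepsilon=-1$. The real vector space $\mathcal{C}_\varepsilon(A)$ is defined as $$\mathcal{C}_\varepsilon(A)=\mathbb{R}\text{-span}\{M\in\mathbb{R}^{(n+1)\times(n+1)} : \det(M)\neq 0,\ M=M^T,\ A^TMA=\varepsilon M\}.$$ *)

theory Defs
  imports "HOL-Analysis.Analysis" "HOL-Computational_Algebra.Polynomial"
begin

definition similar_matrix :: "'a::field^'n^'n \<Rightarrow> 'a^'n^'n \<Rightarrow> bool" where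
  "similar_matrix A B \<longleftrightarrow> (\<exists>P. invertible P \<and> A = P ** B ** matrix_inv P)"

definition diagonal_matrix :: "'a::zero^'n^'n \<Rightarrow> bool" where
  "diagonal_matrix D \<longleftrightarrow> (\<forall>i j. i \<noteq> j \<longrightarrow> D $ i $ j = 0)"

definition complex_matrix :: "real^'n^'m \<Rightarrow> complex^'n^'m" where
  "complex_matrix A = map_matrix complex_of_real A"

definition semisimple :: "real^'n^'n \<Rightarrow> bool" where
  "semisimple A \<longleftrightarrow> (\<exists>D. diagonal_matrix D \<and> similar_matrix (complex_matrix A) D)"

text \<open>Here \<open>mat [:0, 1:]\<close> is the identity matrix times the indeterminate,
  and \<open>det\<close> is taken over the polynomial ring.\<close>

definition charpoly :: "'a::comm_ring_1^'n^'n \<Rightarrow> 'a poly" where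
  "charpoly A = det (mat [:0, 1:] - map_matrix (\<lambda>a. [:a:]) A)"

definition eigenvalue :: "'a::field^'n^'n \<Rightarrow> 'a \<Rightarrow> bool" where
  "eigenvalue A c \<longleftrightarrow> (\<exists>v. v \<noteq> 0 \<and> A *v v = c *s v)"

text \<open>The order of vanishing is \<open>0\<close> at complex numbers that are not eigenvalues.\<close>

definition alg_mult :: "real^'n^'n \<Rightarrow> complex \<Rightarrow> nat" where
  "alg_mult A c = order c (charpoly (complex_matrix A))"

definition sqrt_sign :: "real \<Rightarrow> complex" where
  "sqrt_sign \<epsilon> = (if \<epsilon> = 1 then 1 else \<i>)"

definition C_space :: "real \<Rightarrow> real^'n^'n \<Rightarrow> (real^'n^'n) set" where
  "C_space \<epsilon> A =
     span {M. det M \<noteq> 0 \<and> M = transpose M \<and> transpose A ** M ** A = \<epsilon> *\<^sub>R M}"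

definition sigma_set :: "real \<Rightarrow> real^'n^'n \<Rightarrow> complex set" where
  "sigma_set \<epsilon> A =
     {c. eigenvalue (complex_matrix A) c \<and>
         (cmod c < 1 \<or> cmod c = 1 \<and> (if \<epsilon> = 1 then Im c > 0 else Re c > 0))}"

end

theory Submission
  imports Defs
begin

text \<open>
  Write \<open>A = P D P\<inverse>\<close> over the complex numbers with \<open>D = diag d\<close>. The congruence
  \<open>M \<mapsto> P\<^sup>T M P\<close> carries the complex symmetric solutions of \<open>A\<^sup>T M A = \<epsilon> M\<close> to the symmetric
  matrices whose \<open>(i, j)\<close> entry vanishes unless \<open>d i * d j = \<epsilon>\<close>, and the complex solutions are the
  complexification of the real ones. Similarity of \<open>A\<close> and \<open>\<epsilon> A\<inverse>\<close> gives \<open>m \<lambda> = m (\<epsilon> / \<lambda>)\<close>.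
  Hence some involution of the indices exchanges the eigenvalues \<open>\<lambda>\<close> and \<open>\<epsilon> / \<lambda>\<close>, and its
  permutation matrix is an invertible solution for \<open>D\<close>. As \<open>det (X + t Y)\<close> is a polynomial in \<open>t\<close>, an
  invertible solution \<open>X + \<i> Y\<close> forces an invertible real one; by the same argument
  the invertible real solutions span all of them, which reduces the dimension to counting
  the pairs with \<open>d i * d j = \<epsilon>\<close>.
\<close>

section \<open>Matrix inverses, diagonal matrices and real scaling\<close>

lemma matrix_inv_inverse:
  fixes P :: "'a::semiring_1^'n^'m"
  assumes "invertible P"
  shows "P ** matrix_inv P = mat 1" "matrix_inv P ** P = mat 1"
  using someI_ex[OF assms[unfolded invertible_def]] by (auto simp: matrix_inv_def)

lemma matrix_inv_unique:
  fixes P :: "'a::field^'n^'n"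
  assumes "P ** Q = mat 1"
  shows "matrix_inv P = Q"
proof -
  have inv: "invertible P" using assms invertible_right_inverse by blast
  have "matrix_inv P = matrix_inv P ** (P ** Q)" by (simp add: assms)
  also have "\<dots> = Q" by (simp add: matrix_mul_assoc matrix_inv_inverse[OF inv])
  finally show ?thesis .
qed

text \<open>Storing the diagonal as a function turns multiplicities into cardinalities of fibres of
  \<open>d\<close> and the spectrum into \<open>range d\<close>.\<close>

definition diag :: "('n \<Rightarrow> 'a::zero) \<Rightarrow> 'a^'n^'n" where
  "diag d = (\<chi> i j. if i = j then d i else 0)"

lemma diag_mult_left [simp]: "(diag d ** N) $ i $ j = d i * N $ i $ j"
  for N :: "'a::semiring_1^'n^'n"
  by (simp add: diag_def matrix_matrix_mult_def if_distrib if_distribR cong: if_cong)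

lemma diag_mult_right [simp]: "(N ** diag d) $ i $ j = N $ i $ j * d j"
  for N :: "'a::semiring_1^'n^'n"
  by (simp add: diag_def matrix_matrix_mult_def if_distrib if_distribR cong: if_cong)

lemma diag_mult_vec [simp]: "(diag d *v v) $ i = d i * v $ i"
  for v :: "'a::semiring_1^'n"
  by (simp add: diag_def matrix_vector_mult_def if_distrib if_distribR cong: if_cong)

lemma transpose_diag [simp]: "transpose (diag d) = diag d"
  by (auto simp: diag_def transpose_def vec_eq_iff)

lemma matrix_inv_conj_diag:
  fixes P :: "'a::field^'n^'n"
  assumes P: "invertible P" and d: "\<And>i. d i \<noteq> 0"
  shows "matrix_inv (P ** diag d ** matrix_inv P) = P ** diag (\<lambda>i. inverse (d i)) ** matrix_inv P"
proof (rule matrix_inv_unique)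
  let ?Q = "matrix_inv P" and ?E = "diag (\<lambda>i. inverse (d i)) :: 'a^'n^'n"
  have "diag d ** ?E = mat 1"
    using d by (simp add: vec_eq_iff mat_def) (simp add: diag_def)
  moreover have "(P ** diag d ** ?Q) ** (P ** ?E ** ?Q) = P ** (diag d ** (?Q ** P) ** ?E) ** ?Q"
    by (simp only: matrix_mul_assoc)
  ultimately show "(P ** diag d ** ?Q) ** (P ** ?E ** ?Q) = mat 1"
    by (simp add: matrix_inv_inverse[OF P])
qed

lemma scaleR_matrix_mult:
  fixes M :: "'a::real_algebra_1^'n^'m"
  shows "(c *\<^sub>R M) ** N = c *\<^sub>R (M ** N)" "L ** (c *\<^sub>R M) = c *\<^sub>R (L ** M)"
  by (simp_all add: vec_eq_iff matrix_matrix_mult_def scaleR_sum_right)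

lemma transpose_scaleR: "transpose (c *\<^sub>R M) = c *\<^sub>R transpose M"
  by (simp add: vec_eq_iff transpose_def)

lemma transpose_add: "transpose (M + N) = transpose M + transpose N"
  by (simp add: vec_eq_iff transpose_def)

lemma matrix_mult_add_left: "(A + B) ** C = A ** C + B ** C"
  for A :: "'a::semiring_1^'n^'m"
  by (simp add: vec_eq_iff matrix_matrix_mult_def algebra_simps sum.distrib)

lemma transpose_mult_mat_1:
  fixes Q :: "'a::comm_semiring_1^'n^'n"
  assumes "P ** Q = mat 1"
  shows "transpose Q ** transpose P = mat 1"
  by (metis assms matrix_transpose_mul transpose_mat)

section \<open>Characteristic polynomials\<close>

lemma sum_const_poly: "[:sum f S:] = (\<Sum>x\<in>S. [:f x:])"
proof (induction S rule: infinite_finite_induct)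
  case (insert x S)
  then show ?case by (simp flip: insert.IH)
qed auto

lemma const_matrix_mult:
  fixes M :: "'a::comm_ring_1^'n^'m"
  shows "map_matrix (\<lambda>a. [:a:]) (M ** N) = map_matrix (\<lambda>a. [:a:]) M ** map_matrix (\<lambda>a. [:a:]) N"
  by (simp add: vec_eq_iff matrix_matrix_mult_def sum_const_poly mult.commute)

text \<open>Lifted to constant polynomial matrices, the conjugation fixes the scalar matrix
  \<open>?X\<close>, so it conjugates the whole characteristic matrix; the determinants of the two
  outer factors multiply to 1.\<close>

lemma charpoly_conj:
  fixes P :: "'a::field^'n^'n"
  assumes "invertible P"
  shows "charpoly (P ** B ** matrix_inv P) = charpoly B"
proof -
  let ?c = "map_matrix (\<lambda>a. [:a:]) :: 'a^'n^'n \<Rightarrow> 'a poly^'n^'n"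
  let ?X = "mat [:0, 1:] :: 'a poly^'n^'n"
  let ?Q = "matrix_inv P"
  have X: "?X = diag (\<lambda>_. [:0, 1:])"
    by (simp add: mat_def diag_def)
  have one: "?c (mat 1) = mat 1"
    by (auto simp: vec_eq_iff mat_def)
  have PQ: "?c P ** ?c ?Q = mat 1"
    by (simp add: const_matrix_mult[symmetric] matrix_inv_inverse[OF assms] one)
  have comm: "?c P ** ?X = ?X ** ?c P"
    by (simp add: X vec_eq_iff mult.commute)
  have sub: "?c P ** (U - V) ** ?c ?Q = ?c P ** U ** ?c ?Q - ?c P ** V ** ?c ?Q" for U V
    by (simp add: vec_eq_iff matrix_matrix_mult_def sum_subtractf algebra_simps)
  have "?X - ?c (P ** B ** ?Q) = ?c P ** (?X - ?c B) ** ?c ?Q"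
    unfolding sub by (simp add: comm const_matrix_mult matrix_mul_assoc[symmetric] PQ)
  then have "charpoly (P ** B ** ?Q) = (det (?c P) * det (?c ?Q)) * charpoly B"
    by (simp add: charpoly_def det_mul mult_ac)
  also have "det (?c P) * det (?c ?Q) = 1"
    by (metis PQ det_I det_mul)
  finally show ?thesis by simp
qed

lemma charpoly_diag: "charpoly (diag d :: 'a::comm_ring_1^'n^'n) = (\<Prod>i\<in>UNIV. [:- d i, 1:])"
  unfolding charpoly_def
  by (subst det_diagonal) (auto simp: diag_def mat_def)

lemma order_prod_linear:
  fixes d :: "'n \<Rightarrow> 'a::field"
  assumes "finite S"
  shows "order c (\<Prod>i\<in>S. [:- d i, 1:]) = card {i\<in>S. d i = c}"
  using assms
proof (induction S)
  case (insert x S)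
  have "order c [:- d x, 1:] = (if d x = c then 1 else 0)"
    using order_power_n_n[of c 1] by (auto intro: order_0I)
  moreover have "{i \<in> insert x S. d i = c} = (if d x = c then insert x {i\<in>S. d i = c} else {i\<in>S. d i = c})"
    by auto
  \<comment> \<open>The rule \<open>order_mult\<close> asks for a nonzero product.\<close>
  moreover have "[:- d x, 1:] * (\<Prod>i\<in>S. [:- d i, 1:]) \<noteq> 0"
    using insert.hyps by (subst mult_eq_0_iff) (simp add: prod_zero_iff)
  ultimately show ?case
    using insert by (simp add: order_mult del: mult_pCons_left)
qed auto

text \<open>Bridge from \<open>alg_mult\<close> to counting: a multiplicity becomes the number of
  indices at which \<open>d\<close> takes a given value.\<close>

lemma order_charpoly_conj_diag:
  fixes P :: "'a::field^'n^'n"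
  assumes "invertible P"
  shows "order c (charpoly (P ** diag d ** matrix_inv P)) = card {i. d i = c}"
  by (simp add: charpoly_conj[OF assms] charpoly_diag order_prod_linear)

lemma eigenvalue_conj_diag:
  fixes P :: "'a::field^'n^'n"
  assumes P: "invertible P"
  shows "eigenvalue (P ** diag d ** matrix_inv P) c \<longleftrightarrow> c \<in> range d"
proof
  assume "eigenvalue (P ** diag d ** matrix_inv P) c"
  then obtain v where v: "v \<noteq> 0" "(P ** diag d ** matrix_inv P) *v v = c *s v"
    unfolding eigenvalue_def by blast
  \<comment> \<open>The coordinates of \<open>v\<close> in the basis of columns of \<open>P\<close>;
    in them the eigenvector equation decouples.\<close>
  define w where "w = matrix_inv P *v v"
  have "w \<noteq> 0"
  proof
    assume "w = 0"
    then have "(P ** matrix_inv P) *v v = 0"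
      by (simp only: matrix_vector_mul_assoc[symmetric] matrix_vector_mult_0_right w_def)
    then show False using v(1) by (simp add: matrix_inv_inverse[OF P])
  qed
  have "diag d *v w = (matrix_inv P ** P) *v (diag d *v w)"
    by (simp add: matrix_inv_inverse[OF P])
  also have "\<dots> = matrix_inv P *v (c *s v)"
    unfolding w_def v(2)[symmetric] by (simp only: matrix_vector_mul_assoc matrix_mul_assoc)
  also have "\<dots> = c *s w"
    unfolding w_def by (rule vec.scale)
  finally have "d i * w $ i = c * w $ i" for i
    by (metis diag_mult_vec vector_smult_component)
  moreover obtain i where "w $ i \<noteq> 0" using \<open>w \<noteq> 0\<close> by (auto simp: vec_eq_iff)
  ultimately have "d i = c" by (metis mult_cancel_right)
  then show "c \<in> range d" by blast
next
  assume "c \<in> range d"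
  then obtain i where i: "c = d i" by blast
  let ?w = "axis i 1 :: 'a^'n"
  have "diag d *v ?w = c *s ?w"
    by (auto simp: vec_eq_iff axis_def i)
  then have "P *v (diag d *v ?w) = c *s (P *v ?w)"
    using vec.scale[of P c ?w] by simp
  moreover have "P ** diag d ** matrix_inv P ** P = P ** diag d"
    by (simp add: matrix_mul_assoc[symmetric] matrix_inv_inverse[OF P])
  ultimately have "(P ** diag d ** matrix_inv P) *v (P *v ?w) = c *s (P *v ?w)"
    by (simp add: matrix_vector_mul_assoc)
  moreover have "P *v ?w \<noteq> 0"
  proof
    assume "P *v ?w = 0"
    then have "(matrix_inv P ** P) *v ?w = 0"
      by (simp only: matrix_vector_mul_assoc[symmetric] matrix_vector_mult_0_right)
    then show False by (simp add: matrix_inv_inverse[OF P] axis_eq_0_iff)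
  qed
  ultimately show "eigenvalue (P ** diag d ** matrix_inv P) c"
    unfolding eigenvalue_def by blast
qed

section \<open>Symmetric forms scaled by a matrix\<close>

text \<open>Without the determinant condition of \<open>C_space\<close> the solutions form a real
  subspace. Leaving the field open lets the real problem and its complexification share the
  definition; dimensions are over the reals in both.\<close>

definition sym_forms :: "real \<Rightarrow> 'a::real_normed_field^'n^'n \<Rightarrow> ('a^'n^'n) set" where
  "sym_forms \<epsilon> A = {M. transpose M = M \<and> transpose A ** M ** A = \<epsilon> *\<^sub>R M}"

lemma subspace_sym_forms: "subspace (sym_forms \<epsilon> A)"
proof (rule subspaceI)
  show "0 \<in> sym_forms \<epsilon> A"
    by (simp add: sym_forms_def vec_eq_iff matrix_matrix_mult_def transpose_def)
qed (auto simp: sym_forms_def transpose_add transpose_scaleR scaleR_matrix_mult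
    matrix_add_ldistrib matrix_mult_add_left scaleR_add_right)

lemma congruence_sym_forms:
  fixes Q :: "'a::real_normed_field^'n^'n"
  assumes Q: "invertible Q" and N: "N \<in> sym_forms \<epsilon> B"
  shows "transpose Q ** N ** Q \<in> sym_forms \<epsilon> (matrix_inv Q ** B ** Q)"
proof -
  let ?A = "matrix_inv Q ** B ** Q"
  \<comment> \<open>This intertwining relation moves \<open>Q\<close> inside, where the equation for
    \<open>N\<close> and \<open>B\<close> applies.\<close>
  have QA: "Q ** ?A = B ** Q"
    by (simp add: matrix_mul_assoc matrix_inv_inverse[OF Q])
  have sym: "transpose N = N" and form: "transpose B ** N ** B = \<epsilon> *\<^sub>R N"
    using N by (auto simp: sym_forms_def)
  have "transpose ?A ** (transpose Q ** N ** Q) ** ?A = transpose (Q ** ?A) ** N ** (Q ** ?A)"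
    by (simp only: matrix_transpose_mul matrix_mul_assoc)
  also have "\<dots> = transpose Q ** (transpose B ** N ** B) ** Q"
    unfolding QA by (simp only: matrix_transpose_mul matrix_mul_assoc)
  also have "\<dots> = \<epsilon> *\<^sub>R (transpose Q ** N ** Q)"
    by (simp add: form scaleR_matrix_mult)
  finally show ?thesis
    using sym by (simp add: sym_forms_def matrix_transpose_mul matrix_mul_assoc)
qed

lemma linear_congruence: "linear (\<lambda>N::complex^'n^'n. transpose Q ** N ** Q)"
  by (auto intro!: linearI simp: matrix_add_ldistrib matrix_mult_add_left scaleR_matrix_mult)

lemma congruence_inverse:
  fixes Q :: "'a::comm_semiring_1^'n^'n"
  assumes "P ** Q = mat 1"
  shows "transpose Q ** (transpose P ** N ** P) ** Q = N"
proof -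
  have "transpose Q ** (transpose P ** N ** P) ** Q = (transpose Q ** transpose P) ** N ** (P ** Q)"
    by (simp only: matrix_mul_assoc)
  then show ?thesis by (simp add: assms transpose_mult_mat_1[OF assms])
qed

text \<open>Congruence by \<open>?Q\<close> is linear with inverse the congruence by
  \<open>P\<close>, and each carries solutions to solutions.\<close>

lemma dim_sym_forms_conj:
  fixes P D :: "complex^'n^'n"
  assumes P: "invertible P"
  shows "dim (sym_forms \<epsilon> (P ** D ** matrix_inv P)) = dim (sym_forms \<epsilon> D)"
proof -
  let ?Q = "matrix_inv P"
  let ?A = "P ** D ** ?Q"
  have PQ: "P ** ?Q = mat 1" "?Q ** P = mat 1" by (rule matrix_inv_inverse[OF P])+
  have Q: "invertible ?Q" using PQ invertible_def by blast
  have inv: "matrix_inv ?Q = P" by (rule matrix_inv_unique) (rule PQ)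
  have D: "?Q ** ?A ** P = D"
  proof -
    have "?Q ** ?A ** P = (?Q ** P) ** D ** (?Q ** P)" by (simp only: matrix_mul_assoc)
    then show ?thesis by (simp add: PQ)
  qed
  let ?f = "\<lambda>N. transpose ?Q ** N ** ?Q" and ?g = "\<lambda>M. transpose P ** M ** P"
  have "?f ` sym_forms \<epsilon> D = sym_forms \<epsilon> ?A"
  proof (intro equalityI subsetI)
    fix M assume "M \<in> ?f ` sym_forms \<epsilon> D"
    then obtain N where "N \<in> sym_forms \<epsilon> D" "M = ?f N" by (rule imageE)
    then show "M \<in> sym_forms \<epsilon> ?A"
      using congruence_sym_forms[OF Q, of N \<epsilon> D] by (simp only: inv)
  next
    fix M assume "M \<in> sym_forms \<epsilon> ?A"
    then have "?g M \<in> sym_forms \<epsilon> D"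
      using congruence_sym_forms[OF P, of M \<epsilon> ?A] by (simp only: D)
    moreover have "?f (?g M) = M" by (rule congruence_inverse[OF PQ(1)])
    ultimately show "M \<in> ?f ` sym_forms \<epsilon> D" by (metis imageI)
  qed
  moreover
  have "inj ?f"
    by (rule inj_on_inverseI[where g = ?g]) (rule congruence_inverse[OF PQ(2)])
  then have "inj_on ?f (span (sym_forms \<epsilon> D))" by (rule inj_on_subset) simp
  then have "dim (?f ` sym_forms \<epsilon> D) = dim (sym_forms \<epsilon> D)"
    by (rule dim_image_eq[OF linear_congruence])
  ultimately show ?thesis by simp
qed

text \<open>Against diagonal matrices the equation decouples: the entry at \<open>i\<close>,
  \<open>j\<close> is multiplied by \<open>d i * d j\<close> on one side and by \<epsilon> on the
  other.\<close>

lemma sym_forms_diag_iff: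
  fixes d :: "'n::finite \<Rightarrow> 'a::real_normed_field"
  shows "N \<in> sym_forms \<epsilon> (diag d) \<longleftrightarrow>
    (\<forall>i j. N $ i $ j = N $ j $ i) \<and> (\<forall>i j. d i * d j \<noteq> of_real \<epsilon> \<longrightarrow> N $ i $ j = 0)"
proof -
  have "d i * N $ i $ j * d j = \<epsilon> *\<^sub>R N $ i $ j \<longleftrightarrow> (d i * d j - of_real \<epsilon>) * N $ i $ j = 0" for i j
    by (simp add: scaleR_conv_of_real algebra_simps)
  then have "transpose (diag d) ** N ** diag d = \<epsilon> *\<^sub>R N \<longleftrightarrow>
      (\<forall>i j. d i * d j \<noteq> of_real \<epsilon> \<longrightarrow> N $ i $ j = 0)"
    by (auto simp: vec_eq_iff)
  moreover have "transpose N = N \<longleftrightarrow> (\<forall>i j. N $ i $ j = N $ j $ i)"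
    by (auto simp: vec_eq_iff transpose_def)
  ultimately show ?thesis
    by (simp add: sym_forms_def)
qed

text \<open>The map \<open>f\<close> stands in for a linear order on the indices. Swapping
  coordinates matches increasing pairs with decreasing ones; together they cover \<open>E\<close>,
  and they overlap exactly in its diagonal pairs.\<close>

lemma card_ordered_pairs:
  fixes E :: "('n::finite \<times> 'n) set" and f :: "'n \<Rightarrow> nat"
  assumes f: "inj f" and E: "sym E"
  shows "2 * card {(i, j) \<in> E. f i \<le> f j} = card E + card {i. (i, i) \<in> E}"
proof -
  let ?Q = "{(i, j) \<in> E. f i \<le> f j}" and ?R = "{(i, j) \<in> E. f j \<le> f i}"
  have "bij_betw prod.swap ?Q ?R"
    by (rule bij_betw_byWitness[where f' = prod.swap]) (use E in \<open>auto dest: symD\<close>)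
  then have "card ?R = card ?Q"
    by (simp add: bij_betw_same_card)
  moreover have "?Q \<union> ?R = E"
    by auto
  moreover have "?Q \<inter> ?R = (\<lambda>i. (i, i)) ` {i. (i, i) \<in> E}"
    by (auto dest!: antisym simp: inj_eq[OF f])
  moreover have "card ((\<lambda>i. (i, i)) ` {i. (i, i) \<in> E}) = card {i. (i, i) \<in> E}"
    by (rule card_image) (auto simp: inj_on_def)
  ultimately show ?thesis
    using card_Un_Int[of ?Q ?R] by simp
qed

text \<open>The dimension is over the reals, so each free complex entry counts twice, through the
  basis vectors for 1 and \<i>.\<close>

lemma dim_matrix_support:
  fixes Q :: "('n::finite \<times> 'n) set"
  shows "dim {N :: complex^'n^'n. \<forall>i j. (i, j) \<notin> Q \<longrightarrow> N $ i $ j = 0} = 2 * card Q"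
proof -
  define B :: "(complex^'n^'n) set" where "B = (\<lambda>((i, j), u). axis i (axis j u)) ` (Q \<times> {1, \<i>})"
  have "inj_on (\<lambda>((i, j), u). axis i (axis j u) :: complex^'n^'n) (Q \<times> {1, \<i>})"
    by (auto simp: inj_on_def axis_eq_axis)
  then have card: "card B = 2 * card Q"
    unfolding B_def by (simp add: card_image card_cartesian_product)
  have mem: "axis i (axis j u) \<in> B \<longleftrightarrow> (i, j) \<in> Q" if "u \<in> {1, \<i>}" for i j u
  proof
    show "(i, j) \<in> Q \<Longrightarrow> axis i (axis j u) \<in> B"
      unfolding B_def using that by (intro image_eqI[of _ _ "((i, j), u)"]) auto
  qed (use that in \<open>auto simp: B_def axis_eq_axis\<close>)
  have "{N :: complex^'n^'n. \<forall>i j. (i, j) \<notin> Q \<longrightarrow> N $ i $ j = 0} = {N. \<forall>b\<in>Basis. b \<notin> B \<longrightarrow> N \<bullet> b = 0}"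
    by (auto simp: Basis_vec_def Basis_complex_def inner_axis mem complex_eq_iff)
  moreover have "B \<subseteq> Basis"
    by (auto simp: B_def Basis_complex_def)
  ultimately show ?thesis
    by (simp add: dim_substandard card)
qed

text \<open>A symmetric matrix is determined by the entries on one side of its diagonal, so the real
  dimension is twice the number of ordered pairs that \<open>card_ordered_pairs\<close>
  counts.\<close>

lemma dim_sym_forms_diag:
  fixes d :: "'n::finite \<Rightarrow> complex"
  shows "dim (sym_forms \<epsilon> (diag d)) =
    card {(i, j). d i * d j = of_real \<epsilon>} + card {i. d i * d i = of_real \<epsilon>}"
proof -
  define E where "E = {(i, j). d i * d j = of_real \<epsilon>}"
  let ?T = "sym_forms \<epsilon> (diag d)"
  obtain f :: "'n \<Rightarrow> nat" where f: "inj f"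
    using finite_imp_inj_to_nat_seg[of "UNIV :: 'n set"] by auto
  let ?Q = "{(i, j) \<in> E. f i \<le> f j}"
  let ?U = "{N :: complex^'n^'n. \<forall>i j. (i, j) \<notin> ?Q \<longrightarrow> N $ i $ j = 0}"
  \<comment> \<open>\<open>upper\<close> keeps the entries in increasing position for
    \<open>f\<close>, and \<open>mirror\<close> rebuilds a symmetric matrix from them; they are
    mutually inverse between \<open>?T\<close> and \<open>?U\<close>.\<close>
  define upper :: "complex^'n^'n \<Rightarrow> complex^'n^'n"
    where "upper N = (\<chi> i j. if f i \<le> f j then N $ i $ j else 0)" for N
  define mirror :: "complex^'n^'n \<Rightarrow> complex^'n^'n"
    where "mirror N = (\<chi> i j. if f i \<le> f j then N $ i $ j else N $ j $ i)" for N
  have T: "N \<in> ?T \<longleftrightarrow> (\<forall>i j. N $ i $ j = N $ j $ i) \<and> (\<forall>i j. (i, j) \<notin> E \<longrightarrow> N $ i $ j = 0)" for N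
    by (simp add: sym_forms_diag_iff E_def)
  have symE: "sym E" by (auto simp: E_def sym_def mult.commute)
  have mirror_upper: "mirror (upper N) = N" if "N \<in> ?T" for N
    using that by (auto simp: T mirror_def upper_def vec_eq_iff)
  have "upper ` ?T = ?U"
  proof (intro equalityI subsetI)
    fix N assume N: "N \<in> ?U"
    have "mirror N \<in> ?T"
      unfolding T
    proof (intro conjI allI impI)
      fix i j
      \<comment> \<open>For distinct indices injectivity of \<open>f\<close> leaves exactly one
        order, so both sides read the same entry.\<close>
      show "mirror N $ i $ j = mirror N $ j $ i"
        using f by (auto simp: mirror_def dest: injD)
      show "mirror N $ i $ j = 0" if "(i, j) \<notin> E"
        using that N symE by (auto simp: mirror_def sym_def)
    qed
    moreover have "upper (mirror N) = N"
      using N by (auto simp: mirror_def upper_def vec_eq_iff)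
    ultimately show "N \<in> upper ` ?T" by (metis imageI)
  qed (auto simp: T upper_def)
  moreover have "linear upper"
    by (auto intro!: linearI simp: upper_def vec_eq_iff)
  moreover have "inj_on upper (span ?T)"
    using subspace_sym_forms[of \<epsilon> "diag d"] mirror_upper
    by (metis inj_on_inverseI span_eq_iff)
  ultimately have "dim ?U = dim ?T"
    using dim_image_eq[of upper ?T] by simp
  then have "dim ?T = 2 * card ?Q"
    by (simp only: dim_matrix_support)
  then show ?thesis
    using card_ordered_pairs[OF f symE] by (simp add: E_def)
qed

section \<open>Complexification\<close>

lemma complex_matrix_mult: "complex_matrix (X ** Y) = complex_matrix X ** complex_matrix Y"
  by (simp add: complex_matrix_def vec_eq_iff matrix_matrix_mult_def)

lemma complex_matrix_mat_1: "complex_matrix (mat 1) = mat 1"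
  by (auto simp: complex_matrix_def vec_eq_iff mat_def)

lemma complex_matrix_scaleR: "complex_matrix (c *\<^sub>R X) = c *\<^sub>R complex_matrix X"
  by (simp add: complex_matrix_def vec_eq_iff complex_eq_iff)

lemma complex_matrix_inv:
  fixes X :: "real^'n^'n"
  assumes "invertible X"
  shows "invertible (complex_matrix X)" "matrix_inv (complex_matrix X) = complex_matrix (matrix_inv X)"
proof -
  have *: "complex_matrix X ** complex_matrix (matrix_inv X) = mat 1"
    by (simp add: complex_matrix_mult[symmetric] matrix_inv_inverse[OF assms] complex_matrix_mat_1)
  then show "invertible (complex_matrix X)" using invertible_right_inverse by blast
  show "matrix_inv (complex_matrix X) = complex_matrix (matrix_inv X)"
    by (rule matrix_inv_unique) (rule *)
qed

definition Re_Im_matrix :: "real^'n^'m \<Rightarrow> real^'n^'m \<Rightarrow> complex^'n^'m" where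
  "Re_Im_matrix X Y = (\<chi> i j. Complex (X $ i $ j) (Y $ i $ j))"

lemma Re_Im_matrix_eq_iff: "Re_Im_matrix X Y = Re_Im_matrix X' Y' \<longleftrightarrow> X = X' \<and> Y = Y'"
  by (auto simp: Re_Im_matrix_def vec_eq_iff)

lemma Re_Im_matrix_cases: obtains X Y where "M = Re_Im_matrix X Y"
proof
  show "M = Re_Im_matrix (map_matrix Re M) (map_matrix Im M)"
    by (simp add: Re_Im_matrix_def vec_eq_iff)
qed

lemma Re_Im_matrix_mult:
  "complex_matrix B ** Re_Im_matrix X Y = Re_Im_matrix (B ** X) (B ** Y)"
  "Re_Im_matrix X Y ** complex_matrix B = Re_Im_matrix (X ** B) (Y ** B)"
  by (simp_all add: vec_eq_iff complex_eq_iff Re_Im_matrix_def complex_matrix_def matrix_matrix_mult_def)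

lemma transpose_Re_Im_matrix: "transpose (Re_Im_matrix X Y) = Re_Im_matrix (transpose X) (transpose Y)"
  by (simp add: Re_Im_matrix_def transpose_def vec_eq_iff)

lemma transpose_complex_matrix: "transpose (complex_matrix A) = complex_matrix (transpose A)"
  by (simp add: complex_matrix_def transpose_def vec_eq_iff)

text \<open>Multiplication by the real matrix \<open>A\<close> acts separately on real and imaginary
  parts, so the equation splits.\<close>

lemma Re_Im_matrix_sym_forms_iff:
  "Re_Im_matrix X Y \<in> sym_forms \<epsilon> (complex_matrix A) \<longleftrightarrow> X \<in> sym_forms \<epsilon> A \<and> Y \<in> sym_forms \<epsilon> A"
proof -
  have "\<epsilon> *\<^sub>R Re_Im_matrix X Y = Re_Im_matrix (\<epsilon> *\<^sub>R X) (\<epsilon> *\<^sub>R Y)"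
    by (simp add: Re_Im_matrix_def vec_eq_iff complex_eq_iff)
  then show ?thesis
    by (auto simp: sym_forms_def transpose_Re_Im_matrix transpose_complex_matrix
        Re_Im_matrix_mult Re_Im_matrix_eq_iff)
qed

lemma dim_sym_forms_complex_matrix:
  "dim (sym_forms \<epsilon> (complex_matrix A)) = 2 * dim (sym_forms \<epsilon> A)"
proof -
  let ?S = "sym_forms \<epsilon> A" and ?f = "\<lambda>(X, Y). Re_Im_matrix X Y"
  have "?f ` (?S \<times> ?S) = sym_forms \<epsilon> (complex_matrix A)"
  proof (intro equalityI subsetI)
    fix M assume M: "M \<in> sym_forms \<epsilon> (complex_matrix A)"
    obtain X Y where "M = Re_Im_matrix X Y" by (rule Re_Im_matrix_cases)
    with M show "M \<in> ?f ` (?S \<times> ?S)"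
      by (auto simp: Re_Im_matrix_sym_forms_iff intro!: image_eqI[of _ _ "(X, Y)"])
  qed (auto simp: Re_Im_matrix_sym_forms_iff)
  moreover have "linear ?f"
    by (auto intro!: linearI simp: Re_Im_matrix_def vec_eq_iff complex_eq_iff)
  moreover have "inj_on ?f (span (?S \<times> ?S))"
    by (auto simp: inj_on_def Re_Im_matrix_eq_iff)
  ultimately have "dim (sym_forms \<epsilon> (complex_matrix A)) = dim (?S \<times> ?S)"
    using dim_image_eq[of ?f "?S \<times> ?S"] by simp
  then show ?thesis
    by (simp add: dim_Times subspace_sym_forms)
qed

section \<open>Invertible forms\<close>

text \<open>Evaluation at \<open>t\<close> is a ring homomorphism and so commutes with the
  determinant.\<close>

lemma poly_det: "poly (det M) t = det (map_matrix (\<lambda>p. poly p t) M)"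
  for M :: "'a::comm_ring_1 poly^'n^'n"
proof -
  \<comment> \<open>Permutation signs enter \<open>det_def\<close> through
    \<open>of_int\<close>.\<close>
  have "poly (of_int k) t = of_int k" for k
    by (cases k) (simp_all add: poly_of_nat)
  then show ?thesis
    by (simp add: det_def poly_sum poly_prod)
qed

lemma det_complex_matrix: "det (complex_matrix X) = of_real (det X)"
  by (simp add: det_def complex_matrix_def)

text \<open>A polynomial in \<open>t\<close> that is nonzero at one point \<open>s\<close> has
  finitely many roots. The point is \<i> when passing from complex to real forms, and 0 when
  spanning by invertible forms.\<close>

lemma finite_singular_pencil:
  fixes X Y :: "'a::field^'n^'n"
  assumes "det (\<chi> i j. X $ i $ j + s * Y $ i $ j) \<noteq> 0"
  shows "finite {t. det (\<chi> i j. X $ i $ j + t * Y $ i $ j) = 0}"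
proof -
  let ?p = "det (\<chi> i j. [:X $ i $ j, Y $ i $ j:])"
  have p: "poly ?p t = det (\<chi> i j. X $ i $ j + t * Y $ i $ j)" for t
    by (simp add: poly_det map_matrix_def)
  with assms have "?p \<noteq> 0" by (metis poly_0)
  then show ?thesis
    using poly_roots_finite[of ?p] by (simp add: p)
qed

lemma invertible_sym_form_real:
  assumes M: "M \<in> sym_forms \<epsilon> (complex_matrix A)" and det: "det M \<noteq> 0"
  obtains X where "X \<in> sym_forms \<epsilon> A" "det X \<noteq> 0"
proof -
  obtain X Y where XY: "M = Re_Im_matrix X Y" by (rule Re_Im_matrix_cases)
  let ?pencil = "\<lambda>t. \<chi> i j. complex_matrix X $ i $ j + t * complex_matrix Y $ i $ j"
  have "M = ?pencil \<i>"
    by (simp add: XY Re_Im_matrix_def complex_matrix_def vec_eq_iff complex_eq_iff)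
  with det have "finite {t. det (?pencil t) = 0}"
    by (intro finite_singular_pencil[of _ \<i>]) simp
  \<comment> \<open>Finitely many bad parameters cannot exhaust the real line, so some real
    \<open>t\<close> gives an invertible form.\<close>
  moreover have "infinite (range complex_of_real)"
    by (simp add: finite_image_iff inj_of_real infinite_UNIV_char_0)
  ultimately have "\<not> range complex_of_real \<subseteq> {t. det (?pencil t) = 0}"
    using finite_subset by blast
  then obtain t where t: "det (?pencil (complex_of_real t)) \<noteq> 0"
    by blast
  have "?pencil (complex_of_real t) = complex_matrix (X + t *\<^sub>R Y)"
    by (simp add: complex_matrix_def vec_eq_iff)
  with t have "det (X + t *\<^sub>R Y) \<noteq> 0"
    by (simp add: det_complex_matrix)
  moreover have "X + t *\<^sub>R Y \<in> sym_forms \<epsilon> A"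
    using M by (simp add: XY Re_Im_matrix_sym_forms_iff subspace_add subspace_scale subspace_sym_forms)
  ultimately show thesis by (rule that[rotated])
qed

text \<open>Each solution \<open>N\<close> is a multiple of the difference of two invertible
  solutions, \<open>X + t *\<^sub>R N\<close> and \<open>X\<close>, for a nonzero \<open>t\<close>
  off a finite set.\<close>

lemma C_space_eq_sym_forms:
  assumes X: "X \<in> sym_forms \<epsilon> A" and det: "det X \<noteq> 0"
  shows "C_space \<epsilon> A = sym_forms \<epsilon> A"
proof -
  let ?G = "{M \<in> sym_forms \<epsilon> A. det M \<noteq> 0}"
  have "C_space \<epsilon> A = span ?G"
    unfolding C_space_def sym_forms_def by (rule arg_cong[where f = span]) auto
  moreover have "span ?G \<subseteq> sym_forms \<epsilon> A"
    by (rule span_minimal) (auto simp: subspace_sym_forms)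
  moreover have "N \<in> span ?G" if N: "N \<in> sym_forms \<epsilon> A" for N
  proof -
    have "finite {t. det (\<chi> i j. X $ i $ j + t * N $ i $ j) = 0}"
      using det by (intro finite_singular_pencil[of _ 0]) (simp add: vec_lambda_eta)
    \<comment> \<open>Zero joins the excluded set because the conclusion divides by
      \<open>t\<close>.\<close>
    then have "finite (insert 0 {t. det (\<chi> i j. X $ i $ j + t * N $ i $ j) = 0})"
      by simp
    then obtain t where t: "t \<noteq> 0" "det (\<chi> i j. X $ i $ j + t * N $ i $ j) \<noteq> 0"
      using ex_new_if_finite[OF infinite_UNIV_char_0[where 'a = real]] by blast
    have eq: "(\<chi> i j. X $ i $ j + t * N $ i $ j) = X + t *\<^sub>R N"
      by (simp add: vec_eq_iff)
    have "X \<in> ?G" "X + t *\<^sub>R N \<in> ?G"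
      using X N det t(2) by (auto simp: eq subspace_add subspace_scale subspace_sym_forms)
    then have "(1 / t) *\<^sub>R ((X + t *\<^sub>R N) - X) \<in> span ?G"
      by (intro span_scale span_diff span_base)
    then show ?thesis using t(1) by simp
  qed
  ultimately show ?thesis by blast
qed

text \<open>Arbitrary bijections between paired fibres need not compose to the identity.
  \<open>R\<close> selects one value from each pair of distinct values exchanged by
  \<open>g\<close>; the bijection is used over the selected value, its inverse over the other, and
  the identity over fixed values.\<close>

lemma fibre_involution:
  fixes d :: "'n::finite \<Rightarrow> 'c"
  assumes card: "\<And>c. card {i. d i = g c} = card {i. d i = c}"
    and gg: "\<And>i. g (g (d i)) = d i"
    and R: "\<And>i. g (d i) \<noteq> d i \<Longrightarrow> R (d i) \<longleftrightarrow> \<not> R (g (d i))"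
  obtains \<tau> where "\<And>i. \<tau> (\<tau> i) = i" "\<And>i. d (\<tau> i) = g (d i)"
proof -
  have "\<exists>h. bij_betw h {i. d i = c} {i. d i = g c}" for c
    using card[of c] by (intro finite_same_card_bij) auto
  then obtain f where f: "\<And>c. bij_betw (f c) {i. d i = c} {i. d i = g c}"
    by metis
  define h where "h c = inv_into {i. d i = c} (f c)" for c
  have h: "f c (h c i) = i" "d (h c i) = c" if "d i = g c" for c i
    using bij_betw_inv_into_right[OF f, of i c] bij_betw_apply[OF bij_betw_inv_into[OF f], of i c] that
    by (auto simp: h_def)
  have f': "h c (f c i) = i" "d (f c i) = g c" if "d i = c" for c i
    using bij_betw_inv_into_left[OF f, of i c] bij_betw_apply[OF f, of i c] that
    by (auto simp: h_def)
  \<comment> \<open>In the last branch \<open>i\<close> lies over \<open>g (g (d i))\<close>, the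
    target fibre of the bijection attached to \<open>g (d i)\<close>, which \<open>h\<close>
    inverts.\<close>
  define \<tau> where "\<tau> i = (if g (d i) = d i then i else if R (d i) then f (d i) i else h (g (d i)) i)" for i
  have "d (\<tau> i) = g (d i)" for i
    using f'(2)[of i "d i"] h(2)[of i "g (d i)"] by (auto simp: \<tau>_def gg)
  moreover have "\<tau> (\<tau> i) = i" for i
  proof (cases "g (d i) = d i")
    case False
    show ?thesis
    proof (cases "R (d i)")
      case True
      then have "\<tau> i = f (d i) i" using False by (simp add: \<tau>_def)
      moreover have "\<tau> (f (d i) i) = h (d i) (f (d i) i)"
        using True False R[OF False] f'(2)[of i "d i"] by (simp add: \<tau>_def gg)
      ultimately show ?thesis by (simp add: f')
    next
      case nR: False
      let ?j = "h (g (d i)) i"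
      have "\<tau> i = ?j" using False nR by (simp add: \<tau>_def)
      moreover have "\<tau> ?j = f (g (d i)) ?j"
        using nR False R[OF False] h(2)[of i "g (d i)"] by (auto simp add: \<tau>_def gg)
      ultimately show ?thesis using h(1)[of i "g (d i)"] by (simp add: gg)
    qed
  qed (simp add: \<tau>_def)
  ultimately show thesis by (rule that[rotated])
qed

text \<open>The permutation matrix of an involution is symmetric and its own inverse; the second
  hypothesis places its support on the admissible entries.\<close>

lemma invertible_sym_form_diag:
  fixes d :: "'n::finite \<Rightarrow> 'a::real_normed_field"
  assumes inv: "\<And>i. \<tau> (\<tau> i) = i" and d: "\<And>i. d i * d (\<tau> i) = of_real \<epsilon>"
  obtains N where "N \<in> sym_forms \<epsilon> (diag d)" "invertible N"
proof
  let ?N = "(\<chi> i j. if j = \<tau> i then 1 else 0) :: 'a^'n^'n"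
  have "?N $ i $ j = ?N $ j $ i" for i j
    using inv[of i] inv[of j] by auto
  moreover have "?N $ i $ j = 0" if "d i * d j \<noteq> of_real \<epsilon>" for i j
    using that d[of i] by auto
  ultimately show "?N \<in> sym_forms \<epsilon> (diag d)"
    unfolding sym_forms_diag_iff by blast
  have "?N ** ?N = mat 1"
  proof -
    have "(?N ** ?N) $ i $ j = (\<Sum>k\<in>UNIV. if k = \<tau> i then ?N $ k $ j else 0)" for i j
      unfolding matrix_matrix_mult_def vec_lambda_beta by (rule sum.cong[OF refl]) simp
    then have "(?N ** ?N) $ i $ j = (if j = \<tau> (\<tau> i) then 1 else 0)" for i j
      by simp
    then show ?thesis by (auto simp: vec_eq_iff mat_def inv)
  qed
  then show "invertible ?N"
    using invertible_right_inverse by blast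
qed

section \<open>Eigenvalue multiplicities\<close>

lemma scaleR_conj_diag:
  fixes P :: "complex^'n^'n"
  shows "\<epsilon> *\<^sub>R (P ** diag e ** Q) = P ** diag (\<lambda>i. \<epsilon> *\<^sub>R e i) ** Q"
proof -
  have "diag (\<lambda>i. \<epsilon> *\<^sub>R e i) = \<epsilon> *\<^sub>R (diag e :: complex^'n^'n)"
    by (simp add: diag_def vec_eq_iff)
  then show ?thesis by (simp add: scaleR_matrix_mult)
qed

text \<open>Similarity survives complexification, so \<open>A\<close> and \<epsilon> times its
  inverse share a characteristic polynomial. The same \<open>P\<close> diagonalizes both, with
  entries \<open>d i\<close> and \<epsilon> over \<open>d i\<close>; the orders at \<open>c\<close>
  are then compared.\<close>

lemma card_fibre_similar:
  fixes A :: "real^'n^'n" and d :: "'n \<Rightarrow> complex"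
  assumes P: "invertible P" and A: "complex_matrix A = P ** diag d ** matrix_inv P"
    and inv: "invertible A" and sim: "similar_matrix A (\<epsilon> *\<^sub>R matrix_inv A)"
    and d: "\<And>i. d i \<noteq> 0" and \<epsilon>: "\<epsilon> \<noteq> 0"
  shows "card {i. d i = of_real \<epsilon> / c} = card {i. d i = c}"
proof -
  obtain R where R: "invertible R" and AR: "A = R ** (\<epsilon> *\<^sub>R matrix_inv A) ** matrix_inv R"
    using sim unfolding similar_matrix_def by blast
  have "complex_matrix A = complex_matrix R ** (\<epsilon> *\<^sub>R matrix_inv (complex_matrix A)) ** matrix_inv (complex_matrix R)"
    by (subst AR) (simp only: complex_matrix_mult complex_matrix_scaleR complex_matrix_inv[OF R] complex_matrix_inv[OF inv])
  also have "\<epsilon> *\<^sub>R matrix_inv (complex_matrix A) = P ** diag (\<lambda>i. \<epsilon> *\<^sub>R inverse (d i)) ** matrix_inv P"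
    unfolding A matrix_inv_conj_diag[OF P d] by (rule scaleR_conj_diag)
  finally have "charpoly (complex_matrix A) = charpoly (P ** diag (\<lambda>i. \<epsilon> *\<^sub>R inverse (d i)) ** matrix_inv P)"
    using charpoly_conj[OF complex_matrix_inv(1)[OF R]] by simp
  then have "card {i. d i = c} = card {i. \<epsilon> *\<^sub>R inverse (d i) = c}"
    unfolding A by (metis order_charpoly_conj_diag[OF P])
  also have "{i. \<epsilon> *\<^sub>R inverse (d i) = c} = {i. d i = of_real \<epsilon> / c}"
    \<comment> \<open>At \<open>c = 0\<close> division yields 0, and both sets are empty.\<close>
    using d \<epsilon> by (cases "c = 0") (auto simp: scaleR_conv_of_real field_simps)
  finally show ?thesis by simp
qed

text \<open>The condition of \<open>sigma_set\<close> detached from being an eigenvalue, so that it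
  can serve as the selector \<open>R\<close> of \<open>fibre_involution\<close>.\<close>

definition half_rep :: "real \<Rightarrow> complex \<Rightarrow> bool" where
  "half_rep \<epsilon> c \<longleftrightarrow> cmod c < 1 \<or> cmod c = 1 \<and> (if \<epsilon> = 1 then Im c > 0 else Re c > 0)"

text \<open>Off the unit circle, inversion exchanges inside and outside. On it, \<epsilon> over
  \<open>c\<close> is \<epsilon> times the conjugate, which flips the sign of exactly the coordinate
  tested.\<close>

lemma half_rep_swap:
  assumes \<epsilon>: "\<epsilon> \<in> {1, -1}" and c: "c \<noteq> 0" "of_real \<epsilon> / c \<noteq> c"
  shows "half_rep \<epsilon> c \<longleftrightarrow> \<not> half_rep \<epsilon> (of_real \<epsilon> / c)"
proof (cases "cmod c = 1")
  case True
  then have inv: "of_real \<epsilon> / c = \<epsilon> *\<^sub>R cnj c"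
    using c(1) by (simp add: divide_conv_cnj scaleR_conv_of_real)
  \<comment> \<open>Were this coordinate zero, \<open>c\<close> would be a fixed point.\<close>
  have "(if \<epsilon> = 1 then Im c else Re c) \<noteq> 0"
    using c(2) \<epsilon> unfolding inv by (auto simp: complex_eq_iff)
  then show ?thesis
    using \<epsilon> True unfolding inv half_rep_def by auto
next
  case False
  have "cmod (of_real \<epsilon> / c) = 1 / cmod c"
    using \<epsilon> by (auto simp: norm_divide)
  moreover have "1 / cmod c < 1 \<longleftrightarrow> cmod c > 1" "1 / cmod c \<noteq> 1"
    using c(1) False by (simp_all add: divide_less_eq_1 field_simps)
  ultimately show ?thesis
    using False by (auto simp: half_rep_def)
qed

text \<open>The fixed points 1, -1 or \<i>, -\<i> lie on the unit circle, where the tested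
  coordinate vanishes.\<close>

lemma half_rep_fixed:
  assumes "\<epsilon> \<in> {1, -1}" "c\<^sup>2 = of_real \<epsilon>"
  shows "\<not> half_rep \<epsilon> c"
proof -
  have "(cmod c)\<^sup>2 = 1" using assms by (auto simp flip: norm_power)
  then have "cmod c = 1" by (simp add: power2_eq_1_iff) (use norm_ge_zero[of c] in linarith)
  moreover have "c = 1 \<or> c = -1" if "\<epsilon> = 1" using assms that by (simp add: power2_eq_1_iff)
  moreover have "c = \<i> \<or> c = -\<i>" if "\<epsilon> = -1"
    using assms that power2_eq_iff[of c \<i>] by simp
  ultimately show ?thesis using assms(1) by (auto simp: half_rep_def)
qed

lemma sqrt_sign_square_iff:
  assumes "\<epsilon> \<in> {1, -1}"
  shows "c\<^sup>2 = of_real \<epsilon> \<longleftrightarrow> c = sqrt_sign \<epsilon> \<or> c = - sqrt_sign \<epsilon>"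
  using assms power2_eq_iff[of c \<i>] by (auto simp: sqrt_sign_def power2_eq_1_iff)

lemma sum_card_fibre:
  fixes d :: "'n::finite \<Rightarrow> 'c" and h :: "'c \<Rightarrow> nat"
  shows "(\<Sum>i\<in>UNIV. h (d i)) = (\<Sum>c\<in>range d. card {i. d i = c} * h c)"
  by (subst sum.image_gen[of UNIV _ d]) (auto intro!: sum.cong)

text \<open>Each \<open>i\<close> has \<open>m (d i)\<close> partners, so the pairs number the sum
  of \<open>m c ^ 2\<close> over the spectrum. This splits into the fixed points \<open>F\<close>,
  the representatives \<open>H\<close> and their partners, which contribute as much as
  \<open>H\<close>. The linear terms come from pairs with equal indices.\<close>

lemma card_product_pairs:
  fixes d :: "'n::finite \<Rightarrow> complex"
  assumes \<epsilon>: "\<epsilon> \<in> {1, -1}" and d: "\<And>i. d i \<noteq> 0"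
    and card: "\<And>c. card {i. d i = of_real \<epsilon> / c} = card {i. d i = c}"
  defines "m \<equiv> \<lambda>c. card {i. d i = c}" and "s \<equiv> sqrt_sign \<epsilon>"
  shows "card {(i, j). d i * d j = of_real \<epsilon>} + card {i. d i * d i = of_real \<epsilon>} =
    m s ^ 2 + m s + m (- s) ^ 2 + m (- s) + 2 * (\<Sum>c\<in>{c \<in> range d. half_rep \<epsilon> c}. m c ^ 2)"
proof -
  let ?g = "\<lambda>c. of_real \<epsilon> / c"
  define H where "H = {c \<in> range d. half_rep \<epsilon> c}"
  define F where "F = {c \<in> range d. c = s \<or> c = - s}"
  have \<epsilon>0: "\<epsilon> \<noteq> 0" using \<epsilon> by auto
  have s: "s \<noteq> - s" using \<epsilon> by (auto simp: s_def sqrt_sign_def complex_eq_iff)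
  have gg: "?g (?g c) = c" for c :: complex using \<epsilon>0 by simp
  have range: "c \<in> range d \<longleftrightarrow> m c \<noteq> 0" for c
    by (auto simp: m_def)
  have g_range: "?g c \<in> range d \<longleftrightarrow> c \<in> range d" for c
    using card[of c] by (simp only: range m_def)
  have nz: "c \<noteq> 0" if "c \<in> range d" for c using that d by auto
  have fixed: "?g c = c \<longleftrightarrow> c = s \<or> c = - s" if "c \<in> range d" for c
    using nz[OF that] sqrt_sign_square_iff[OF \<epsilon>, of c]
    by (auto simp: s_def field_simps power2_eq_square)
  have not_half: "\<not> half_rep \<epsilon> c" if "c = s \<or> c = - s" for c
    using that half_rep_fixed[OF \<epsilon>] sqrt_sign_square_iff[OF \<epsilon>, of c] by (simp add: s_def)
  have "card {(i, j). d i * d j = of_real \<epsilon>} = card (SIGMA i:UNIV. {j. d i * d j = of_real \<epsilon>})"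
    by (rule arg_cong[where f = card]) auto
  also have "\<dots> = (\<Sum>i\<in>UNIV. card {j. d i * d j = of_real \<epsilon>})"
    by simp
  also have "\<dots> = (\<Sum>i\<in>UNIV. m (d i))"
  proof (rule sum.cong[OF refl])
    fix i
    have "{j. d i * d j = of_real \<epsilon>} = {j. d j = ?g (d i)}"
      using d by (auto simp: field_simps)
    then show "card {j. d i * d j = of_real \<epsilon>} = m (d i)"
      by (simp add: card m_def)
  qed
  also have "\<dots> = (\<Sum>c\<in>range d. m c ^ 2)"
    using sum_card_fibre[of m d] by (simp only: power2_eq_square m_def)
  also have "range d = F \<union> (H \<union> ?g ` H)"
  proof (intro equalityI subsetI)
    fix c assume c: "c \<in> range d"
    show "c \<in> F \<union> (H \<union> ?g ` H)"
    proof (cases "c = s \<or> c = - s \<or> half_rep \<epsilon> c")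
      case False
      then have "half_rep \<epsilon> (?g c)"
        using half_rep_swap[OF \<epsilon> nz[OF c]] fixed[OF c] by simp
      then have "?g c \<in> H" using c g_range by (simp add: H_def)
      then have "?g (?g c) \<in> ?g ` H" by (rule imageI)
      then show ?thesis unfolding gg by simp
    qed (use c in \<open>auto simp: F_def H_def\<close>)
  next
    fix c assume "c \<in> F \<union> (H \<union> ?g ` H)"
    then show "c \<in> range d"
      using g_range by (auto simp: F_def H_def)
  qed
  also have "(\<Sum>c\<in>F \<union> (H \<union> ?g ` H). m c ^ 2) = (\<Sum>c\<in>F. m c ^ 2) + (\<Sum>c\<in>H \<union> ?g ` H. m c ^ 2)"
  proof (rule sum.union_disjoint)
    have "?g c \<notin> F" if "c \<in> H" for c
    proof -
      have c: "c \<in> range d" "half_rep \<epsilon> c" using that by (simp_all add: H_def)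
      then have "?g c \<in> range d" using g_range by simp
      then have "c = ?g c \<longleftrightarrow> ?g c = s \<or> ?g c = - s"
        using fixed[of "?g c"] unfolding gg by simp
      moreover have "c \<noteq> ?g c"
        using c fixed[of c] not_half[of c] by metis
      ultimately have "\<not> (?g c = s \<or> ?g c = - s)" by blast
      then show ?thesis unfolding F_def by auto
    qed
    moreover have "c \<notin> H" if "c \<in> F" for c
      using that not_half by (simp add: F_def H_def)
    ultimately show "F \<inter> (H \<union> ?g ` H) = {}" by blast
  qed (simp_all add: F_def H_def)
  also have "(\<Sum>c\<in>H \<union> ?g ` H. m c ^ 2) = (\<Sum>c\<in>H. m c ^ 2) + (\<Sum>c\<in>?g ` H. m c ^ 2)"
  proof (rule sum.union_disjoint)
    have "?g c \<notin> H" if "c \<in> H" for c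
    proof -
      have c: "c \<in> range d" "half_rep \<epsilon> c" using that by (simp_all add: H_def)
      then have "?g c \<noteq> c" using fixed[of c] not_half[of c] by blast
      then show ?thesis using half_rep_swap[OF \<epsilon> nz] c by (simp add: H_def)
    qed
    then show "H \<inter> ?g ` H = {}" by blast
  qed (simp_all add: H_def)
  also have "(\<Sum>c\<in>?g ` H. m c ^ 2) = (\<Sum>c\<in>H. m c ^ 2)"
  proof (subst sum.reindex)
    show "inj_on ?g H" by (rule inj_on_inverseI) (rule gg)
    show "sum ((\<lambda>c. m c ^ 2) \<circ> ?g) H = (\<Sum>c\<in>H. m c ^ 2)"
      by (simp add: m_def card)
  qed
  \<comment> \<open>A square root of \<epsilon> outside the spectrum has \<open>m\<close> equal to
    0, so it may be added to the sum.\<close>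
  also have "(\<Sum>c\<in>F. m c ^ 2) = (\<Sum>c\<in>{s, - s}. m c ^ 2)"
    by (rule sum.mono_neutral_left) (auto simp: F_def range)
  also have "\<dots> = m s ^ 2 + m (- s) ^ 2"
    using s by simp
  finally have pairs: "card {(i, j). d i * d j = of_real \<epsilon>} =
      m s ^ 2 + m (- s) ^ 2 + 2 * (\<Sum>c\<in>H. m c ^ 2)"
    by simp
  have "{i. d i * d i = of_real \<epsilon>} = {i. d i = s} \<union> {i. d i = - s}"
    using sqrt_sign_square_iff[OF \<epsilon>] by (auto simp: s_def power2_eq_square)
  then have "card {i. d i * d i = of_real \<epsilon>} = m s + m (- s)"
    using s by (simp only: m_def) (rule card_Un_disjoint, auto)
  with pairs show ?thesis by (simp add: H_def)
qed

section \<open>Existence of an invertible form and the dimension formula\<close>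

theorem theorem12:
  fixes n :: nat and \<epsilon> :: real and A :: "real^'d^'d"
  assumes "n \<ge> 2" and "CARD('d) = n + 1"
    and "\<epsilon> \<in> {1, -1}"
    and "semisimple A" and "invertible A"
    and "similar_matrix A (\<epsilon> *\<^sub>R matrix_inv A)"
  shows "(\<exists>M :: real^'d^'d. M = transpose M \<and> invertible M \<and>
            transpose A ** M ** A = \<epsilon> *\<^sub>R M) \<and>
         real (dim (C_space \<epsilon> A)) =
           (real (alg_mult A (sqrt_sign \<epsilon>)) ^ 2 + real (alg_mult A (sqrt_sign \<epsilon>))
            + real (alg_mult A (- sqrt_sign \<epsilon>)) ^ 2 + real (alg_mult A (- sqrt_sign \<epsilon>))) / 2
           + (\<Sum>c\<in>sigma_set \<epsilon> A. real (alg_mult A c) ^ 2)"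
proof -
  note \<epsilon> = \<open>\<epsilon> \<in> {1, -1}\<close>
  have \<epsilon>0: "\<epsilon> \<noteq> 0" using \<epsilon> by auto
  obtain D P :: "complex^'d^'d" where "diagonal_matrix D" and P: "invertible P"
    and AD: "complex_matrix A = P ** D ** matrix_inv P"
    using \<open>semisimple A\<close> unfolding semisimple_def similar_matrix_def by blast
  define d where "d = (\<lambda>i. D $ i $ i)"
  have "D = diag d"
    using \<open>diagonal_matrix D\<close> by (auto simp: diagonal_matrix_def d_def diag_def vec_eq_iff)
  with AD have A: "complex_matrix A = P ** diag d ** matrix_inv P" by simp
  have mult: "alg_mult A c = card {i. d i = c}" for c
    unfolding alg_mult_def A by (rule order_charpoly_conj_diag[OF P])
  have sigma: "sigma_set \<epsilon> A = {c \<in> range d. half_rep \<epsilon> c}"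
    unfolding sigma_set_def A eigenvalue_conj_diag[OF P] half_rep_def by (rule refl)
  \<comment> \<open>Invertibility of \<open>A\<close> excludes the eigenvalue 0, which makes
    \<epsilon> over \<open>d i\<close> a genuine partner.\<close>
  have "det (P ** diag d ** matrix_inv P) \<noteq> 0"
    using complex_matrix_inv(1)[OF \<open>invertible A\<close>] unfolding A invertible_det_nz .
  then have "det (diag d :: complex^'d^'d) \<noteq> 0"
    by (auto simp: det_mul)
  then have d: "d i \<noteq> 0" for i
    by (subst (asm) det_diagonal) (auto simp: diag_def)
  note card = card_fibre_similar[OF P A \<open>invertible A\<close> \<open>similar_matrix A (\<epsilon> *\<^sub>R matrix_inv A)\<close> d \<epsilon>0]
  obtain \<tau> where \<tau>: "\<And>i. \<tau> (\<tau> i) = i" "\<And>i. d (\<tau> i) = of_real \<epsilon> / d i"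
  proof (rule fibre_involution[where d = d and g = "\<lambda>c. of_real \<epsilon> / c" and R = "half_rep \<epsilon>"])
    show "of_real \<epsilon> / (of_real \<epsilon> / d i) = d i" for i using \<epsilon>0 by simp
  qed (use card half_rep_swap[OF \<epsilon> d] in auto)
  have "d i * d (\<tau> i) = of_real \<epsilon>" for i
    using d[of i] by (simp add: \<tau>(2))
  then obtain N where N: "N \<in> sym_forms \<epsilon> (diag d)" "invertible N"
    using invertible_sym_form_diag[OF \<tau>(1)] by blast
  let ?Q = "matrix_inv P"
  have PQ: "P ** ?Q = mat 1" "?Q ** P = mat 1" by (rule matrix_inv_inverse[OF P])+
  have Q: "invertible ?Q" using PQ unfolding invertible_def by blast
  have "matrix_inv ?Q = P" by (rule matrix_inv_unique) (rule PQ)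
  then have "transpose ?Q ** N ** ?Q \<in> sym_forms \<epsilon> (complex_matrix A)"
    using congruence_sym_forms[OF Q N(1)] by (simp only: A)
  moreover have "det (transpose ?Q ** N ** ?Q) \<noteq> 0"
    using N(2) Q by (simp add: det_mul invertible_det_nz)
  ultimately obtain M where M: "M \<in> sym_forms \<epsilon> A" "det M \<noteq> 0"
    by (rule invertible_sym_form_real)
  \<comment> \<open>The factor 2 is the passage to real dimension of the complexification; it
    cancels the denominator of the formula.\<close>
  have "2 * dim (C_space \<epsilon> A) = dim (sym_forms \<epsilon> (complex_matrix A))"
    by (simp add: C_space_eq_sym_forms[OF M] dim_sym_forms_complex_matrix)
  also have "\<dots> = dim (sym_forms \<epsilon> (diag d))"
    unfolding A by (rule dim_sym_forms_conj[OF P])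
  also have "\<dots> = alg_mult A (sqrt_sign \<epsilon>) ^ 2 + alg_mult A (sqrt_sign \<epsilon>)
      + alg_mult A (- sqrt_sign \<epsilon>) ^ 2 + alg_mult A (- sqrt_sign \<epsilon>)
      + 2 * (\<Sum>c\<in>sigma_set \<epsilon> A. alg_mult A c ^ 2)"
    unfolding mult sigma dim_sym_forms_diag by (rule card_product_pairs[OF \<epsilon> d card])
  finally have "real (2 * dim (C_space \<epsilon> A)) = real \<dots>"
    by (rule arg_cong)
  then have "real (dim (C_space \<epsilon> A)) =
           (real (alg_mult A (sqrt_sign \<epsilon>)) ^ 2 + real (alg_mult A (sqrt_sign \<epsilon>))
            + real (alg_mult A (- sqrt_sign \<epsilon>)) ^ 2 + real (alg_mult A (- sqrt_sign \<epsilon>))) / 2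
           + (\<Sum>c\<in>sigma_set \<epsilon> A. real (alg_mult A c) ^ 2)"
    by (simp add: field_simps)
  moreover have "transpose M = M" "transpose A ** M ** A = \<epsilon> *\<^sub>R M" "invertible M"
    using M by (auto simp: sym_forms_def invertible_det_nz)
  ultimately show ?thesis by metis
qed

end
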